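(* For every constant degree bound $d$, every constant treewidth bound $t$ and every constant $\varepsilon\in(0,1)$, $3$-partiteness is strongly testable within the class of $3$-uniform $n$-vertex hypergraphs of maximum degree at most $d$ whose Gaifman graph has treewidth at most $t$: there is an $\varepsilon$-tester for $3$-partiteness, for inputs promised to lie in this class, whose query complexity does not depend on $n$.
   Context: A hypergraph is $3$-uniform if every hyperedge has exactly $3$ vertices; it is $3$-partite if there is a map $V(H)\to\{1,2,3\}$ giving the three vertices of every hyperedge three distinct colors. The Gaifman (primal) graph of $H$ has vertex set $V(H)$, two vertices adjacent iff they lie in a common hyperedge; the treewidth of $H$ is that of its Gaifman graph. Bounded degree model: a hypergraph of maximum degree at most $d$ is accessed via queries to lists $A_1,\dots,A_n$ of length $d$, $A_i$ listing the hyperedges incident to $i$ padded with $\bot$. Distance between $H_1=([n],E_1)$, $H_2=([n],E_2)$ is $(|E_1\setminus E_2|+|E_2\setminus E_1|)/(dn)$; $H$ is $\varepsilon$-far from a property if its distance to every $3$-uniform $n$-vertex hypergraph with the property exceeds $\varepsilon$. An $\varepsilon$-tester accepts with probability $\ge 2/3$ inputs with the property and with probability $\le 1/3$ inputs $\varepsilon$-far from it. Strongly testable means such a tester exists with query complexity independent of $n$. *)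

theory Defs
  imports "HOL-Probability.Probability" "HOL-Library.Extended_Nat"
begin

section \<open>Graphs, trees and treewidth\<close>

text \<open>Simple graphs are given by a vertex set and a set of two-element edges.\<close>

definition adjacency :: "'a set set \<Rightarrow> ('a \<times> 'a) set" where
  "adjacency E = {(u, v). {u, v} \<in> E}"

definition connected_within :: "'a set set \<Rightarrow> 'a set \<Rightarrow> bool" where
  "connected_within E S \<longleftrightarrow> (\<forall>u\<in>S. \<forall>v\<in>S. (u, v) \<in> (adjacency E \<inter> S \<times> S)\<^sup>*)"

definition graph_cycle :: "'a set set \<Rightarrow> 'a list \<Rightarrow> bool" where
  "graph_cycle E p \<longleftrightarrow> length p \<ge> 3 \<and> distinct p \<and>
     (\<forall>i<length p. {p ! i, p ! (Suc i mod length p)} \<in> E)"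

definition finite_tree :: "'a set \<Rightarrow> 'a set set \<Rightarrow> bool" where
  "finite_tree V E \<longleftrightarrow> finite V \<and> V \<noteq> {} \<and> (\<forall>e\<in>E. e \<subseteq> V \<and> card e = 2) \<and>
     connected_within E V \<and> (\<nexists>p. graph_cycle E p)"

definition tree_decomposition ::
  "'a set \<Rightarrow> 'a set set \<Rightarrow> 'i set \<Rightarrow> 'i set set \<Rightarrow> ('i \<Rightarrow> 'a set) \<Rightarrow> bool" where
  "tree_decomposition V E I F B \<longleftrightarrow> finite_tree I F \<and>
     (\<Union>i\<in>I. B i) = V \<and>
     (\<forall>e\<in>E. \<exists>i\<in>I. e \<subseteq> B i) \<and>
     (\<forall>v\<in>V. connected_within F {i \<in> I. v \<in> B i})"

text \<open>The subtraction truncates, so the graph without vertices gets treewidth 0 rather than -1.\<close>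

definition decomposition_width :: "'i set \<Rightarrow> ('i \<Rightarrow> 'a set) \<Rightarrow> nat" where
  "decomposition_width I B = Max ((\<lambda>i. card (B i)) ` I) - 1"

text \<open>The nodes of a finite tree can be taken to be natural numbers. For finite graphs the
  one-bag decomposition shows that the minimum is over a nonempty set.\<close>

definition treewidth :: "'a set \<Rightarrow> 'a set set \<Rightarrow> nat" where
  "treewidth V E = (LEAST w. \<exists>(I :: nat set) F B.
     tree_decomposition V E I F B \<and> decomposition_width I B = w)"

section \<open>Hypergraphs\<close>

definition hypergraph :: "'a set \<Rightarrow> 'a set set \<Rightarrow> bool" where
  "hypergraph V E \<longleftrightarrow> finite V \<and> (\<forall>e\<in>E. e \<subseteq> V)"

definition three_uniform :: "'a set set \<Rightarrow> bool" where
  "three_uniform E \<longleftrightarrow> (\<forall>e\<in>E. card e = 3)"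

definition three_partite :: "'a set \<Rightarrow> 'a set set \<Rightarrow> bool" where
  "three_partite V E \<longleftrightarrow> (\<exists>c \<in> V \<rightarrow> {1, 2, 3 :: nat}. \<forall>e\<in>E. inj_on c e)"

definition incident :: "'a set set \<Rightarrow> 'a \<Rightarrow> 'a set set" where
  "incident E v = {e \<in> E. v \<in> e}"

definition max_degree_at_most :: "'a set \<Rightarrow> 'a set set \<Rightarrow> nat \<Rightarrow> bool" where
  "max_degree_at_most V E d \<longleftrightarrow> (\<forall>v\<in>V. card (incident E v) \<le> d)"

definition gaifman_edges :: "'a set set \<Rightarrow> 'a set set" where
  "gaifman_edges E = {{u, v} | u v. u \<noteq> v \<and> (\<exists>e\<in>E. u \<in> e \<and> v \<in> e)}"

definition hypergraph_treewidth :: "'a set \<Rightarrow> 'a set set \<Rightarrow> nat" where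
  "hypergraph_treewidth V E = treewidth V (gaifman_edges E)"

section \<open>The bounded degree model\<close>

text \<open>The vertex set of an \<open>n\<close>-vertex hypergraph is \<open>{..<n}\<close>. The input is a list of \<open>n\<close> lists;
  \<open>None\<close> is the padding symbol. The order in which a list presents the incident hyperedges
  is arbitrary.\<close>

type_synonym incidence_lists = "nat set option list list"

definition represents :: "nat \<Rightarrow> nat \<Rightarrow> incidence_lists \<Rightarrow> nat set set \<Rightarrow> bool" where
  "represents d n A E \<longleftrightarrow> length A = n \<and>
     (\<forall>i<n. length (A ! i) = d \<and>
        (\<exists>es. distinct es \<and> set es = incident E i \<and>
              A ! i = map Some es @ replicate (d - length es) None))"

definition query_answer :: "incidence_lists \<Rightarrow> nat \<Rightarrow> nat \<Rightarrow> nat set option" where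
  "query_answer A i j = (if i < length A \<and> j < length (A ! i) then A ! i ! j else None)"

text \<open>Randomized query algorithms: \<open>Choose m f\<close> draws \<open>r\<close> uniformly from \<open>{..m}\<close> and continues
  with \<open>f r\<close>; \<open>Query i j f\<close> reads entry \<open>j\<close> of list \<open>i\<close> and continues with \<open>f\<close> applied to the
  answer. Every run is finite because the type is a datatype.\<close>

datatype query_algorithm =
    Accept
  | Reject
  | Choose nat "nat \<Rightarrow> query_algorithm"
  | Query nat nat "nat set option \<Rightarrow> query_algorithm"

primrec run :: "incidence_lists \<Rightarrow> query_algorithm \<Rightarrow> bool pmf" where
  "run A Accept = return_pmf True"
| "run A Reject = return_pmf False"
| "run A (Choose m f) = bind_pmf (pmf_of_set {..m}) (\<lambda>r. run A (f r))"
| "run A (Query i j f) = run A (f (query_answer A i j))"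

definition accept_prob :: "query_algorithm \<Rightarrow> incidence_lists \<Rightarrow> real" where
  "accept_prob T A = pmf (run A T) True"

text \<open>The worst-case number of queries, over all random choices and all answers.\<close>

primrec query_complexity :: "query_algorithm \<Rightarrow> enat" where
  "query_complexity Accept = 0"
| "query_complexity Reject = 0"
| "query_complexity (Choose m f) = (SUP r\<in>{..m}. query_complexity (f r))"
| "query_complexity (Query i j f) = eSuc (SUP a. query_complexity (f a))"

section \<open>Property testing\<close>

definition edge_distance :: "nat \<Rightarrow> nat \<Rightarrow> nat set set \<Rightarrow> nat set set \<Rightarrow> real" where
  "edge_distance d n E1 E2 = (real (card (E1 - E2)) + real (card (E2 - E1))) / (real d * real n)"

text \<open>A property (or class) is a predicate on the number of vertices and the hyperedge set.\<close>

definition far_from ::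
  "nat \<Rightarrow> nat \<Rightarrow> real \<Rightarrow> (nat \<Rightarrow> nat set set \<Rightarrow> bool) \<Rightarrow> nat set set \<Rightarrow> bool" where
  "far_from d n \<epsilon> P E \<longleftrightarrow>
     (\<forall>E'. hypergraph {..<n} E' \<and> three_uniform E' \<and> P n E' \<longrightarrow> edge_distance d n E E' > \<epsilon>)"

text \<open>A tester receives \<open>n\<close>; it may behave arbitrarily on inputs outside the class \<open>C\<close>.\<close>

definition is_tester ::
  "nat \<Rightarrow> real \<Rightarrow> (nat \<Rightarrow> nat set set \<Rightarrow> bool) \<Rightarrow> (nat \<Rightarrow> nat set set \<Rightarrow> bool) \<Rightarrow>
     (nat \<Rightarrow> query_algorithm) \<Rightarrow> bool" where
  "is_tester d \<epsilon> P C T \<longleftrightarrow>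
     (\<forall>n E A. C n E \<and> represents d n A E \<longrightarrow>
        (P n E \<longrightarrow> accept_prob (T n) A \<ge> 2/3) \<and>
        (far_from d n \<epsilon> P E \<longrightarrow> accept_prob (T n) A \<le> 1/3))"

definition bounded_treewidth_class :: "nat \<Rightarrow> nat \<Rightarrow> nat \<Rightarrow> nat set set \<Rightarrow> bool" where
  "bounded_treewidth_class d t n E \<longleftrightarrow>
     hypergraph {..<n} E \<and> three_uniform E \<and> max_degree_at_most {..<n} E d \<and>
     hypergraph_treewidth {..<n} E \<le> t"

end

theory Submission
  imports Defs
begin

text \<open>Bounded treewidth and bounded degree make the hypergraph hyperfinite: deleting the hyperedges
  at a set of at most \<open>\<epsilon> n / 2\<close> vertices leaves components with at most \<open>k\<close> vertices, where \<open>k\<close>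
  depends on \<open>t\<close> and \<open>\<epsilon>\<close> only. If in addition the hyperedges at all vertices with a
  non-3-partite ball of radius \<open>k * k\<close> are deleted, every remaining component lies in the ball of
  one of its vertices that is 3-partite, so the rest is 3-partite. Hence an \<open>\<epsilon>\<close>-far hypergraph has
  more than \<open>\<epsilon> n / 2\<close> vertices with a non-3-partite ball, and exploring the balls around constantly
  many random vertices finds one. The error is one-sided because subhypergraphs of 3-partite
  hypergraphs are 3-partite.\<close>

section \<open>Tree decompositions and separators\<close>

text \<open>The first vertex of a longest path is such a leaf: a neighbor off the path would
  lengthen it, and one at position 2 or later would close a cycle. Isolated vertices qualify too,
  with arbitrary \<open>j\<close>.\<close>

lemma leaf_exists:
  assumes "finite I" "I \<noteq> {}" and F: "\<forall>e\<in>F. e \<subseteq> I \<and> card e = 2"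
    and acyc: "\<nexists>p. graph_cycle F p"
  shows "\<exists>i\<in>I. \<exists>j. \<forall>l. {i, l} \<in> F \<longrightarrow> l = j"
proof -
  define path where "path p \<longleftrightarrow> p \<noteq> [] \<and> distinct p \<and> set p \<subseteq> I \<and>
    (\<forall>m. Suc m < length p \<longrightarrow> {p ! m, p ! Suc m} \<in> F)" for p
  obtain x where "x \<in> I" using assms(2) by blast
  then have px: "path [x]" by (simp add: path_def)
  have "length p < Suc (card I)" if "path p" for p
    using that card_mono[OF assms(1), of "set p"] by (simp add: path_def distinct_card less_Suc_eq_le)
  with px obtain p where p: "path p" and longest: "\<And>q. path q \<Longrightarrow> length q \<le> length p"
    using ex_has_greatest_nat[of path "[x]" length "Suc (card I)"] by auto
  \<comment> \<open>For a one-vertex path \<open>p ! 1\<close> is unspecified, but then no such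
    \<open>l\<close> exists.\<close>
  have "l = p ! 1" if l: "{p ! 0, l} \<in> F" for l
  proof -
    have lI: "l \<in> I" and ne: "l \<noteq> p ! 0" using F l by auto
    have "l \<in> set p"
    proof (rule ccontr)
      assume "l \<notin> set p"
      then have "path (l # p)"
        using p l lI by (auto simp: path_def nth_Cons insert_commute split: nat.split)
      then show False using longest by fastforce
    qed
    then obtain m where m: "m < length p" "l = p ! m" by (metis in_set_conv_nth)
    have "m \<noteq> 0" using ne m by metis
    moreover have "\<not> 2 \<le> m"
    proof
      assume "2 \<le> m"
      have "{take (Suc m) p ! i, take (Suc m) p ! (Suc i mod Suc m)} \<in> F" if "i < Suc m" for i
      proof (cases "i = m")
        case True
        then show ?thesis using l m by (simp add: insert_commute)
      next
        case False
        then show ?thesis using that p m by (simp add: path_def)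
      qed
      then have "graph_cycle F (take (Suc m) p)"
        using \<open>2 \<le> m\<close> m p by (auto simp: graph_cycle_def path_def)
      then show False using acyc by blast
    qed
    ultimately have "m = 1" by linarith
    then show ?thesis using m by simp
  qed
  moreover have "p ! 0 \<in> I" using p by (auto simp: path_def)
  ultimately show ?thesis by blast
qed

text \<open>The running intersection property of join trees. It trades the tree for a list of bags,
  so that the separator can be built by list induction.\<close>

primrec running_intersection :: "'a set list \<Rightarrow> bool" where
  "running_intersection [] \<longleftrightarrow> True"
| "running_intersection (b # bs) \<longleftrightarrow> running_intersection bs \<and>
     (bs \<noteq> [] \<longrightarrow> (\<exists>b'\<in>set bs. b \<inter> \<Union>(set bs) \<subseteq> b'))"

text \<open>A walk visits the leaf \<open>i\<close> only between two visits of \<open>j\<close>, so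
  these detours can be cut out.\<close>

lemma connected_within_remove_leaf:
  assumes conn: "connected_within F S" and leaf: "\<And>l. {i, l} \<in> F \<Longrightarrow> l = j"
  shows "connected_within {e \<in> F. i \<notin> e} (S - {i})"
  unfolding connected_within_def
proof (intro ballI)
  let ?R = "adjacency F \<inter> S \<times> S"
  let ?R' = "adjacency {e \<in> F. i \<notin> e} \<inter> (S - {i}) \<times> (S - {i})"
  fix u v assume u: "u \<in> S - {i}" and v: "v \<in> S - {i}"
  then have "(u, v) \<in> ?R\<^sup>*" using conn by (auto simp: connected_within_def)
  \<comment> \<open>While the walk is at \<open>i\<close>, the shortened walk waits at
    \<open>j\<close>.\<close>
  then have "(v \<noteq> i \<longrightarrow> (u, v) \<in> ?R'\<^sup>*) \<and> (v = i \<longrightarrow> (u, j) \<in> ?R'\<^sup>*)"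
  proof induction
    case base
    then show ?case using u by simp
  next
    case (step y z)
    have yz: "{y, z} \<in> F" "y \<in> S" "z \<in> S" using step.hyps by (auto simp: adjacency_def)
    consider "y = i" | "y \<noteq> i" "z = i" | "y \<noteq> i" "z \<noteq> i" by blast
    then show ?case
    proof cases
      case 1
      then have "z = j" using leaf yz by simp
      then show ?thesis using 1 step.IH by auto
    next
      case 2
      then have "y = j" using leaf yz by (simp add: insert_commute)
      then show ?thesis using 2 step.IH by auto
    next
      case 3
      then have "(y, z) \<in> ?R'" using yz by (auto simp: adjacency_def)
      then show ?thesis using 3 step.IH by (meson rtrancl.rtrancl_into_rtrancl)
    qed
  qed
  then show "(u, v) \<in> ?R'\<^sup>*" using v by simp
qed

text \<open>Induction by leaf removal, the bag of the leaf \<open>i\<close> coming first. A vertex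
  that it shares with another bag lies in the bag of \<open>j\<close> too, because the nodes
  carrying the vertex are connected and \<open>i\<close> can be left only towards
  \<open>j\<close>.\<close>

lemma running_intersection_of_forest:
  assumes "finite I" "\<forall>e\<in>F. e \<subseteq> I \<and> card e = 2" "\<nexists>p. graph_cycle F p"
    and "\<forall>v. connected_within F {i \<in> I. v \<in> B i}"
  shows "\<exists>bs. running_intersection bs \<and> set bs = B ` I"
  using assms
proof (induction "card I" arbitrary: I F)
  case 0
  then have "running_intersection [] \<and> set [] = B ` I" by simp
  then show ?case by blast
next
  case (Suc m)
  have "I \<noteq> {}" using Suc.hyps(2) by auto
  then obtain i j where i: "i \<in> I" and leaf: "\<And>l. {i, l} \<in> F \<Longrightarrow> l = j"
    using leaf_exists[OF Suc.prems(1) _ Suc.prems(2,3)] by metis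
  define I' where "I' = I - {i}"
  define F' where "F' = {e \<in> F. i \<notin> e}"
  have "\<exists>bs. running_intersection bs \<and> set bs = B ` I'"
  proof (rule Suc.hyps(1))
    show "m = card I'" using Suc.hyps(2) Suc.prems(1) i by (simp add: I'_def)
    show "finite I'" using Suc.prems(1) by (simp add: I'_def)
    show "\<forall>e\<in>F'. e \<subseteq> I' \<and> card e = 2" using Suc.prems(2) by (auto simp: I'_def F'_def)
    show "\<nexists>p. graph_cycle F' p" using Suc.prems(3) by (auto simp: graph_cycle_def F'_def)
    have eq: "{l \<in> I'. v \<in> B l} = {l \<in> I. v \<in> B l} - {i}" for v by (auto simp: I'_def)
    have "connected_within F' ({l \<in> I. v \<in> B l} - {i})" for v
      unfolding F'_def by (rule connected_within_remove_leaf) (use Suc.prems(4) leaf in blast)+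
    then show "\<forall>v. connected_within F' {l \<in> I'. v \<in> B l}" unfolding eq by blast
  qed
  then obtain bs where bs: "running_intersection bs" "set bs = B ` I'" by blast
  have toj: "j \<in> I' \<and> v \<in> B j" if v: "v \<in> B i" "v \<in> B l" "l \<in> I'" for v l
  proof -
    let ?S = "{l \<in> I. v \<in> B l}"
    have "(i, l) \<in> (adjacency F \<inter> ?S \<times> ?S)\<^sup>*"
      using Suc.prems(4)[rule_format, of v, unfolded connected_within_def] v i
      unfolding I'_def by blast
    then obtain x where x: "(i, x) \<in> adjacency F \<inter> ?S \<times> ?S"
    proof (cases rule: converse_rtranclE)
      case base
      then show thesis using v(3) by (simp add: I'_def)
    qed
    then have xj: "x = j" using leaf by (auto simp: adjacency_def)
    have "{i, j} \<in> F" using x xj by (auto simp: adjacency_def)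
    then have "card {i, j} = 2" using Suc.prems(2) by blast
    then have "i \<noteq> j" by auto
    then show ?thesis using x xj by (auto simp: I'_def)
  qed
  \<comment> \<open>An isolated \<open>i\<close> has no neighboring bag to offer; the intersection
    is then empty and any bag serves.\<close>
  have "\<exists>b'\<in>set bs. B i \<inter> \<Union>(set bs) \<subseteq> b'" if "bs \<noteq> []"
  proof (cases "B i \<inter> \<Union>(set bs) = {}")
    case True
    then show ?thesis using that by (metis empty_subsetI last_in_set)
  next
    case False
    then obtain v l where "v \<in> B i" "v \<in> B l" "l \<in> I'" using bs by auto
    then have "j \<in> I'" using toj by blast
    moreover have "B i \<inter> \<Union>(set bs) \<subseteq> B j" using toj bs by auto
    ultimately show ?thesis using bs by auto
  qed
  then have "running_intersection (B i # bs)" using bs by simp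
  moreover have "set (B i # bs) = B ` I" using bs i by (auto simp: I'_def)
  ultimately show ?case by blast
qed

lemma treewidth_attained:
  assumes "finite V" and "\<forall>e\<in>E. e \<subseteq> V"
  shows "\<exists>(I :: nat set) F B. tree_decomposition V E I F B \<and> decomposition_width I B = treewidth V E"
proof -
  have "finite_tree {0 :: nat} {}"
    by (auto simp: finite_tree_def connected_within_def graph_cycle_def intro!: exI[of _ 0])
  then have "tree_decomposition V E {0 :: nat} {} (\<lambda>_. V)"
    using assms by (auto simp: tree_decomposition_def connected_within_def)
  then have "\<exists>w. \<exists>(I :: nat set) F B. tree_decomposition V E I F B \<and> decomposition_width I B = w"
    by blast
  then show ?thesis unfolding treewidth_def by (rule LeastI_ex)
qed

lemma treewidth_running_intersection:
  assumes V: "finite V" "\<forall>e\<in>E. e \<subseteq> V" and tw: "treewidth V E \<le> t"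
  obtains bs where "running_intersection bs" "bs \<noteq> []" "\<Union>(set bs) = V"
    "\<And>b. b \<in> set bs \<Longrightarrow> card b \<le> Suc t" "\<And>e. e \<in> E \<Longrightarrow> \<exists>b\<in>set bs. e \<subseteq> b"
proof -
  obtain I :: "nat set" and F B where td: "tree_decomposition V E I F B"
    and w: "decomposition_width I B \<le> t"
    using treewidth_attained[OF V] tw by metis
  have tree: "finite_tree I F" and U: "(\<Union>i\<in>I. B i) = V"
    and cov: "\<forall>e\<in>E. \<exists>i\<in>I. e \<subseteq> B i" and conn: "\<forall>v\<in>V. connected_within F {i \<in> I. v \<in> B i}"
    using td by (auto simp: tree_decomposition_def)
  have "connected_within F {i \<in> I. v \<in> B i}" for v
  proof (cases "v \<in> V")
    case False
    then have empty: "{i \<in> I. v \<in> B i} = {}" using U by blast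
    show ?thesis unfolding connected_within_def empty by simp
  qed (use conn in blast)
  then obtain bs where bs: "running_intersection bs" "set bs = B ` I"
    using running_intersection_of_forest[of I F B] tree by (auto simp: finite_tree_def)
  have "card (B i) \<le> Suc t" if "i \<in> I" for i
  proof -
    have "card (B i) \<le> Max ((\<lambda>i. card (B i)) ` I)"
      using tree that by (simp add: finite_tree_def)
    \<comment> \<open>The truncated subtraction still gives a bag size of at most
      \<open>Suc t\<close>.\<close>
    then show ?thesis using w by (simp add: decomposition_width_def)
  qed
  moreover have "bs \<noteq> []" using bs tree by (auto simp: finite_tree_def)
  ultimately show thesis using that[of bs] bs U cov by auto
qed

section \<open>Decomposition into small pieces and the separator\<close>

text \<open>For symmetric \<open>G\<close> and finite \<open>S\<close>: the components of the graph
  induced on \<open>S\<close> have at most \<open>k\<close> vertices. The closed set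
  \<open>p\<close> stands in for a component, which spares connectivity arguments.\<close>

definition fragmented :: "('a \<times> 'a) set \<Rightarrow> nat \<Rightarrow> 'a set \<Rightarrow> bool" where
  "fragmented G k S \<longleftrightarrow> (\<forall>v\<in>S. \<exists>p\<subseteq>S. v \<in> p \<and> card p \<le> k \<and> (\<forall>u\<in>p. \<forall>w\<in>S. (u, w) \<in> G \<longrightarrow> w \<in> p))"

lemma fragmentedE:
  assumes "fragmented G k S" "v \<in> S"
  obtains p where "p \<subseteq> S" "v \<in> p" "card p \<le> k" "\<forall>u\<in>p. \<forall>w\<in>S. (u, w) \<in> G \<longrightarrow> w \<in> p"
proof -
  obtain p where "p \<subseteq> S \<and> v \<in> p \<and> card p \<le> k \<and> (\<forall>u\<in>p. \<forall>w\<in>S. (u, w) \<in> G \<longrightarrow> w \<in> p)"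
    using assms(1)[unfolded fragmented_def, rule_format, OF assms(2)] by (rule exE)
  then show thesis by (intro that[of p]) simp_all
qed

lemma fragmented_small: "card S \<le> k \<Longrightarrow> fragmented G k S"
  unfolding fragmented_def by blast

lemma fragmented_subset:
  assumes "fragmented G k S" "T \<subseteq> S" "finite S"
  shows "fragmented G k T"
  unfolding fragmented_def
proof
  fix v assume v: "v \<in> T"
  with assms(2) have "v \<in> S" by blast
  with assms(1) obtain p where p: "p \<subseteq> S" "v \<in> p" "card p \<le> k"
    "\<forall>u\<in>p. \<forall>w\<in>S. (u, w) \<in> G \<longrightarrow> w \<in> p"
    by (rule fragmentedE)
  have "card (p \<inter> T) \<le> card p"
    using p(1) assms(3) by (meson card_mono finite_subset inf_le1)
  then show "\<exists>q\<subseteq>T. v \<in> q \<and> card q \<le> k \<and> (\<forall>u\<in>q. \<forall>w\<in>T. (u, w) \<in> G \<longrightarrow> w \<in> q)"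
    using p v assms(2) by (intro exI[of _ "p \<inter> T"]) auto
qed

lemma fragmented_Un:
  assumes "fragmented G k S" "fragmented G k T" "sym G"
    and nonadj: "\<And>u w. u \<in> S \<Longrightarrow> w \<in> T \<Longrightarrow> (u, w) \<notin> G"
  shows "fragmented G k (S \<union> T)"
  unfolding fragmented_def
proof
  have extend: "\<exists>p\<subseteq>A \<union> B. v \<in> p \<and> card p \<le> k \<and> (\<forall>u\<in>p. \<forall>w\<in>A \<union> B. (u, w) \<in> G \<longrightarrow> w \<in> p)"
    if A: "fragmented G k A" "v \<in> A" and "\<And>u w. u \<in> A \<Longrightarrow> w \<in> B \<Longrightarrow> (u, w) \<notin> G" for v A B
  proof -
    from A obtain p where "p \<subseteq> A" "v \<in> p" "card p \<le> k"
      "\<forall>u\<in>p. \<forall>w\<in>A. (u, w) \<in> G \<longrightarrow> w \<in> p"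
      by (rule fragmentedE)
    then show ?thesis using that(3) by (intro exI[of _ p]) blast
  qed
  have nonadj': "(u, w) \<notin> G" if "u \<in> T" "w \<in> S" for u w
    using nonadj[of w u] assms(3) that by (meson symD)
  fix v assume "v \<in> S \<union> T"
  then show "\<exists>p\<subseteq>S \<union> T. v \<in> p \<and> card p \<le> k \<and> (\<forall>u\<in>p. \<forall>w\<in>S \<union> T. (u, w) \<in> G \<longrightarrow> w \<in> p)"
  proof
    assume "v \<in> S"
    then show ?thesis by (rule extend[OF assms(1)]) (rule nonadj)
  next
    assume "v \<in> T"
    then show ?thesis unfolding Un_commute[of S T] by (rule extend[OF assms(2)]) (rule nonadj')
  qed
qed

text \<open>The leaf bags are removed one by one. A vertex that has lost its last bag goes to \<open>U\<close> and hangs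
  at the bag \<open>h u\<close>, which contains all its remaining neighbors outside its own group. When more than
  \<open>k\<close> vertices hang at a leaf, its bag is put into \<open>X\<close> and these vertices pay for it.\<close>

lemma separator_aux:
  assumes "sym G" "running_intersection bs" "bs \<noteq> []"
    and "\<forall>b\<in>set bs. finite b \<and> card b \<le> s" "finite U" "U \<inter> \<Union>(set bs) = {}" "h ` U \<subseteq> set bs"
    and "\<forall>u\<in>\<Union>(set bs). \<forall>v\<in>\<Union>(set bs). (u, v) \<in> G \<longrightarrow> (\<exists>b\<in>set bs. u \<in> b \<and> v \<in> b)"
    and "\<forall>u\<in>U. \<forall>v\<in>U \<union> \<Union>(set bs). (u, v) \<in> G \<longrightarrow> v \<in> h u \<or> v \<in> U \<and> h v = h u"
    and "fragmented G k U"
  shows "\<exists>X\<subseteq>U \<union> \<Union>(set bs). k * card X \<le> s * card (U \<union> \<Union>(set bs)) \<and>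
    fragmented G k (U \<union> \<Union>(set bs) - X)"
  using assms(2-)
proof (induction bs arbitrary: U h)
  case Nil
  then show ?case by simp
next
  case (Cons b bs)
  \<comment> \<open>\<open>D\<close> hangs at the leaf bag \<open>b\<close>, and \<open>P\<close>
    has its last bag there. Deleting \<open>b\<close> either turns \<open>D \<union> P\<close> into
    one group or is charged to it.\<close>
  define D where "D = {u \<in> U. h u = b}"
  define P where "P = b - \<Union>(set bs)"
  have finb: "finite b" "card b \<le> s" using Cons.prems by auto
  have finbs: "finite (\<Union>(set bs))" using Cons.prems by auto
  have finD: "finite D" "finite P" using Cons.prems finb by (auto simp: D_def P_def)
  have symG: "\<And>u v. (u, v) \<in> G \<Longrightarrow> (v, u) \<in> G" using assms(1) by (meson symD)
  have edge_bag: "u \<in> b \<and> v \<in> b \<or> (\<exists>b\<in>set bs. u \<in> b \<and> v \<in> b)"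
    if "u \<in> b \<union> \<Union>(set bs)" "v \<in> b \<union> \<Union>(set bs)" "(u, v) \<in> G" for u v
    using Cons.prems(7)[rule_format, of u v] that by auto
  have dang: "\<And>u v. u \<in> U \<Longrightarrow> v \<in> U \<union> b \<union> \<Union>(set bs) \<Longrightarrow> (u, v) \<in> G \<Longrightarrow> v \<in> h u \<or> v \<in> U \<and> h v = h u"
    using Cons.prems(8) by auto
  have disj: "U \<inter> b = {}" "U \<inter> \<Union>(set bs) = {}" using Cons.prems(5) by auto
  have hU: "\<And>u. u \<in> U \<Longrightarrow> h u = b \<or> h u \<in> set bs" using Cons.prems(6) by auto
  let ?W = "U \<union> \<Union>(set (b # bs))"
  show ?case
  proof (cases "bs = []")
    case True
    \<comment> \<open>At the last bag, either everything left is small, or all of it pays for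
      \<open>b\<close> and only the fragmented \<open>U\<close> remains.\<close>
    show ?thesis
    proof (cases "card ?W \<le> k")
      case True
      then show ?thesis by (intro exI[of _ "{}"]) (simp add: fragmented_small)
    next
      case False
      have "k * card b \<le> card ?W * s" using False finb by (intro mult_mono) auto
      moreover have "?W - b = U" using True disj by auto
      ultimately show ?thesis using Cons.prems(9) by (intro exI[of _ b]) (auto simp: mult.commute)
    qed
  next
    case bs: False
    then obtain b' where b': "b' \<in> set bs" "b \<inter> \<Union>(set bs) \<subseteq> b'" using Cons.prems(1) by auto
    have bags: "\<forall>u\<in>\<Union>(set bs). \<forall>v\<in>\<Union>(set bs). (u, v) \<in> G \<longrightarrow> (\<exists>b\<in>set bs. u \<in> b \<and> v \<in> b)"
    proof (intro ballI impI)
      fix u v assume uv: "u \<in> \<Union>(set bs)" "v \<in> \<Union>(set bs)" "(u, v) \<in> G"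
      then have "u \<in> b \<and> v \<in> b \<or> (\<exists>b\<in>set bs. u \<in> b \<and> v \<in> b)" by (intro edge_bag) auto
      then show "\<exists>b\<in>set bs. u \<in> b \<and> v \<in> b" using b' uv(1,2) by (meson IntI subsetD)
    qed
    \<comment> \<open>A vertex hanging elsewhere is adjacent only to its bag among \<open>bs\<close>
      and to its own group; neither meets \<open>D \<union> P\<close>.\<close>
    have cross: "(u, v) \<notin> G" if "u \<in> U - D" "v \<in> D \<union> P" for u v
      using dang[of u v] hU[of u] that disj by (auto simp: D_def P_def)
    show ?thesis
    proof (cases "card (D \<union> P) \<le> k")
      case True
      \<comment> \<open>The small set \<open>D \<union> P\<close> becomes one group: its outside
        neighbors lie in \<open>b \<inter> \<Union>(set bs)\<close>, which \<open>b'\<close>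
        contains.\<close>
      define h' where "h' u = (if u \<in> D \<union> P then b' else h u)" for u
      have W: "?W = (U \<union> P) \<union> \<Union>(set bs)" by (auto simp: P_def)
      have "\<exists>X\<subseteq>(U \<union> P) \<union> \<Union>(set bs). k * card X \<le> s * card ((U \<union> P) \<union> \<Union>(set bs)) \<and>
          fragmented G k ((U \<union> P) \<union> \<Union>(set bs) - X)"
      proof (rule Cons.IH[where h = h'])
        show "running_intersection bs" "bs \<noteq> []" "\<forall>b\<in>set bs. finite b \<and> card b \<le> s" "finite (U \<union> P)"
          using Cons.prems bs finD by auto
        show "(U \<union> P) \<inter> \<Union>(set bs) = {}" using disj by (auto simp: P_def)
        show "h' ` (U \<union> P) \<subseteq> set bs" using hU b' by (auto simp: h'_def D_def)
        show "\<forall>u\<in>\<Union>(set bs). \<forall>v\<in>\<Union>(set bs). (u, v) \<in> G \<longrightarrow> (\<exists>b\<in>set bs. u \<in> b \<and> v \<in> b)"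
          by (fact bags)
        show "\<forall>u\<in>U \<union> P. \<forall>v\<in>U \<union> P \<union> \<Union>(set bs). (u, v) \<in> G \<longrightarrow> v \<in> h' u \<or> v \<in> U \<union> P \<and> h' v = h' u"
        proof (intro ballI impI)
          fix u v assume u: "u \<in> U \<union> P" and v: "v \<in> U \<union> P \<union> \<Union>(set bs)" and uv: "(u, v) \<in> G"
          show "v \<in> h' u \<or> v \<in> U \<union> P \<and> h' v = h' u"
          proof (cases "u \<in> D \<union> P")
            case uD: True
            have "v \<in> D \<union> P \<or> v \<in> b \<inter> \<Union>(set bs)"
            proof (cases "v \<in> U")
              case True
              then show ?thesis using cross[of v u] symG[OF uv] uD by blast
            next
              case False
              show ?thesis
              proof (cases "u \<in> D")
                case True
                then show ?thesis using dang[of u v] uv v False by (auto simp: D_def P_def)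
              next
                case False
                then show ?thesis using edge_bag[of u v] uv v uD \<open>v \<notin> U\<close> by (auto simp: P_def)
              qed
            qed
            then show ?thesis using b' uD by (auto simp: h'_def D_def)
          next
            case False
            then have "u \<in> U - D" using u by auto
            moreover from this have "v \<notin> D \<union> P" using cross uv by blast
            ultimately show ?thesis using dang[of u v] uv v False by (auto simp: h'_def P_def)
          qed
        qed
        have "fragmented G k ((U - D) \<union> (D \<union> P))"
          using fragmented_subset[OF Cons.prems(9) _ Cons.prems(4)] fragmented_small[OF True] assms(1) cross
          by (intro fragmented_Un[of G k "U - D" "D \<union> P"]) blast+
        then show "fragmented G k (U \<union> P)"
          by (rule back_subst[of "fragmented G k"]) (auto simp: D_def)
      qed
      then show ?thesis unfolding W .
    next
      case False
      let ?W' = "(U - D) \<union> \<Union>(set bs)"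
      have "\<exists>X\<subseteq>?W'. k * card X \<le> s * card ?W' \<and> fragmented G k (?W' - X)"
      proof (rule Cons.IH[where h = h])
        show "running_intersection bs" "bs \<noteq> []" "\<forall>b\<in>set bs. finite b \<and> card b \<le> s" "finite (U - D)"
          using Cons.prems bs by auto
        show "(U - D) \<inter> \<Union>(set bs) = {}" using disj by auto
        show "h ` (U - D) \<subseteq> set bs" using hU by (auto simp: D_def)
        show "\<forall>u\<in>\<Union>(set bs). \<forall>v\<in>\<Union>(set bs). (u, v) \<in> G \<longrightarrow> (\<exists>b\<in>set bs. u \<in> b \<and> v \<in> b)"
          by (fact bags)
        show "\<forall>u\<in>U - D. \<forall>v\<in>U - D \<union> \<Union>(set bs). (u, v) \<in> G \<longrightarrow> v \<in> h u \<or> v \<in> U - D \<and> h v = h u"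
          using dang by (auto simp: D_def)
        show "fragmented G k (U - D)" using Cons.prems(4,9) by (auto elim: fragmented_subset)
      qed
      then obtain X where XW: "X \<subseteq> ?W'" and X: "k * card X \<le> s * card ?W'" "fragmented G k (?W' - X)"
        by blast
      have W: "?W = ?W' \<union> (D \<union> P)" and "?W' \<inter> (D \<union> P) = {}"
        using disj by (auto simp: D_def P_def)
      then have cW: "card ?W = card ?W' + card (D \<union> P)"
        using card_Un_disjoint[of ?W' "D \<union> P"] finD finbs Cons.prems(4) by simp
      have "k * card (b \<union> X) \<le> k * card b + k * card X"
        by (metis card_Un_le distrib_left mult_le_mono2)
      \<comment> \<open>More than \<open>k\<close> vertices pay for the at most \<open>s\<close>
        vertices of \<open>b\<close>; they are disjoint from \<open>?W'\<close>, so they are not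
        charged again.\<close>
      also have "k * card b \<le> card (D \<union> P) * s" using False finb by (intro mult_mono) auto
      finally have 1: "k * card (b \<union> X) \<le> s * card ?W"
        using X(1) unfolding cW by (simp add: algebra_simps)
      \<comment> \<open>\<open>P\<close> disappears with \<open>b\<close>, while \<open>D\<close>
        has neighbors only in itself and in \<open>b\<close>, so it keeps the pieces it had inside
        \<open>U\<close>.\<close>
      have "fragmented G k ((?W' - X - b) \<union> (D - X))"
      proof (rule fragmented_Un)
        show "fragmented G k (?W' - X - b)"
          using X(2) by (rule fragmented_subset) (use finbs Cons.prems(4) in auto)
        show "fragmented G k (D - X)"
          using Cons.prems(9) by (rule fragmented_subset) (use Cons.prems(4) in \<open>auto simp: D_def\<close>)
        show "sym G" by (fact assms(1))
        show "(u, w) \<notin> G" if "u \<in> ?W' - X - b" "w \<in> D - X" for u w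
        proof
          assume uw: "(u, w) \<in> G"
          have w: "w \<in> U" "h w = b" using that(2) by (auto simp: D_def)
          have "u \<notin> U" using cross[of u w] that uw disj(2) by blast
          moreover have "u \<in> h w \<or> u \<in> U"
            using dang[OF w(1) _ symG[OF uw]] that(1) by blast
          ultimately show False using w that(1) by simp
        qed
      qed
      then have "fragmented G k (?W - (b \<union> X))"
        by (rule back_subst[of "fragmented G k"]) (use disj in \<open>auto simp: D_def\<close>)
      moreover have "b \<union> X \<subseteq> ?W" using XW by auto
      ultimately show ?thesis using 1 by blast
    qed
  qed
qed


text \<open>Gaifman adjacency as a relation, with a loop at every vertex that lies in a
  hyperedge.\<close>

definition comember :: "'a set set \<Rightarrow> ('a \<times> 'a) set" where
  "comember E = {(u, v). \<exists>e\<in>E. u \<in> e \<and> v \<in> e}"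

text \<open>The leaf removal starts with no hanging vertices, so \<open>h\<close> is arbitrary. With
  \<open>k\<close> at least \<open>2 * Suc t / \<epsilon>\<close>, the set \<open>X\<close> takes at
  most a fraction \<open>\<epsilon> / 2\<close> of the vertices.\<close>

lemma bounded_treewidth_separator:
  assumes H: "hypergraph V E" and tw: "hypergraph_treewidth V E \<le> t"
  obtains X where "X \<subseteq> V" "k * card X \<le> Suc t * card V" "fragmented (comember E) k (V - X)"
proof -
  have fin: "finite V" and sub: "\<forall>e\<in>gaifman_edges E. e \<subseteq> V"
    using H by (auto simp: hypergraph_def gaifman_edges_def)
  obtain bs where bs: "running_intersection bs" "bs \<noteq> []" "\<Union>(set bs) = V"
    and card_bs: "\<And>b. b \<in> set bs \<Longrightarrow> card b \<le> Suc t"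
    and cover: "\<And>e. e \<in> gaifman_edges E \<Longrightarrow> \<exists>b\<in>set bs. e \<subseteq> b"
    using treewidth_running_intersection[OF fin sub tw[unfolded hypergraph_treewidth_def]] by metis
  have "\<exists>X\<subseteq>{} \<union> \<Union>(set bs). k * card X \<le> Suc t * card ({} \<union> \<Union>(set bs)) \<and>
      fragmented (comember E) k ({} \<union> \<Union>(set bs) - X)"
  proof (rule separator_aux)
    show "sym (comember E)" by (auto simp: sym_def comember_def)
    show "running_intersection bs" "bs \<noteq> []" by (fact bs)+
    show "\<forall>b\<in>set bs. finite b \<and> card b \<le> Suc t"
      using card_bs bs(3) fin by (metis Sup_upper finite_subset)
    show "\<forall>u\<in>\<Union>(set bs). \<forall>v\<in>\<Union>(set bs). (u, v) \<in> comember E \<longrightarrow> (\<exists>b\<in>set bs. u \<in> b \<and> v \<in> b)"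
    proof (intro ballI impI)
      fix u v assume u: "u \<in> \<Union>(set bs)" and uv: "(u, v) \<in> comember E"
      show "\<exists>b\<in>set bs. u \<in> b \<and> v \<in> b"
      proof (cases "u = v")
        case True
        then show ?thesis using u by blast
      next
        case False
        then have "{u, v} \<in> gaifman_edges E"
          using uv unfolding gaifman_edges_def comember_def by blast
        from cover[OF this] show ?thesis by simp
      qed
    qed
    show "(\<lambda>_. undefined) ` {} \<subseteq> set bs" by simp
    show "\<forall>u\<in>{}. \<forall>v\<in>{} \<union> \<Union>(set bs). (u, v) \<in> comember E \<longrightarrow>
        v \<in> (\<lambda>_. undefined) u \<or> v \<in> {} \<and> (\<lambda>_. undefined) v = (\<lambda>_. undefined) u" by simp
  qed (auto simp: fragmented_def)
  then obtain X where "X \<subseteq> V" "k * card X \<le> Suc t * card V" "fragmented (comember E) k (V - X)"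
    by (auto simp: bs(3))
  then show thesis by (rule that)
qed

section \<open>Balls in hypergraphs\<close>

text \<open>The closed neighborhood in the Gaifman graph; its \<open>r\<close>-th iterate from
  \<open>{v}\<close> is the ball of radius \<open>r\<close>.\<close>

definition reach :: "'a set set \<Rightarrow> 'a set \<Rightarrow> 'a set" where
  "reach E U = U \<union> \<Union>{e \<in> E. e \<inter> U \<noteq> {}}"

text \<open>Hyperedges that meet the ball, not only those inside it: these are what reading the
  lists of all ball vertices reveals.\<close>

definition ball_edges :: "'a set set \<Rightarrow> nat \<Rightarrow> 'a \<Rightarrow> 'a set set" where
  "ball_edges E r v = {e \<in> E. e \<inter> (reach E ^^ r) {v} \<noteq> {}}"

lemma reach_funpow_mono: "i \<le> j \<Longrightarrow> (reach E ^^ i) U \<subseteq> (reach E ^^ j) U"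
  by (induction rule: dec_induct) (auto simp: reach_def)

lemma relpow_reach:
  assumes "(v, w) \<in> R ^^ j" "R \<subseteq> comember E"
  shows "w \<in> (reach E ^^ j) {v}"
  using assms(1)
proof (induction j arbitrary: w)
  case (Suc j)
  then obtain u where "(v, u) \<in> R ^^ j" "(u, w) \<in> R" by auto
  then show ?case using Suc.IH[of u] assms(2) by (auto simp: reach_def comember_def)
qed simp

text \<open>The walk stays in \<open>p\<close>, where at most \<open>k * k\<close> pairs are
  available, and a shortest walk needs no more steps than there are pairs. This crude bound fixes
  the radius of the balls.\<close>

lemma rtrancl_reach:
  assumes "(v, w) \<in> R\<^sup>*" "v \<in> p" "finite p" "card p \<le> k" "R \<subseteq> comember E"
    and closed: "\<And>u x. u \<in> p \<Longrightarrow> (u, x) \<in> R \<Longrightarrow> x \<in> p"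
  shows "w \<in> (reach E ^^ (k * k)) {v}"
proof -
  let ?R = "R \<inter> p \<times> p"
  have "(v, w) \<in> ?R\<^sup>* \<and> w \<in> p" using assms(1)
  proof induction
    case (step y z)
    then have "(y, z) \<in> ?R" using closed by blast
    then show ?case using step.IH by (meson IntD2 mem_Sigma_iff rtrancl.rtrancl_into_rtrancl)
  qed (use assms(2) in simp)
  moreover have "finite ?R" using assms(3) by blast
  ultimately obtain j where j: "j \<le> card ?R" "(v, w) \<in> ?R ^^ j"
    by (auto simp: rtrancl_finite_eq_relpow)
  have "card ?R \<le> card (p \<times> p)" using assms(3) by (intro card_mono) auto
  also have "\<dots> \<le> k * k" using assms(4) by (simp add: card_cartesian_product mult_le_mono)
  finally have "j \<le> k * k" using j by linarith
  moreover have "w \<in> (reach E ^^ j) {v}" by (rule relpow_reach[OF j(2)]) (use assms(5) in blast)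
  ultimately show ?thesis by (rule subsetD[OF reach_funpow_mono])
qed

section \<open>Counting deleted hyperedges and bad balls\<close>

lemma card_touching_edges:
  assumes "hypergraph V E" "max_degree_at_most V E d" "Y \<subseteq> V"
  shows "card {e \<in> E. e \<inter> Y \<noteq> {}} \<le> d * card Y"
proof -
  have "finite Y" using assms by (auto simp: hypergraph_def intro: finite_subset)
  have "{e \<in> E. e \<inter> Y \<noteq> {}} = (\<Union>v\<in>Y. incident E v)" by (auto simp: incident_def)
  also have "card \<dots> \<le> (\<Sum>v\<in>Y. card (incident E v))" using \<open>finite Y\<close> by (rule card_UN_le)
  also have "\<dots> \<le> (\<Sum>v\<in>Y. d)" using assms by (intro sum_mono) (auto simp: max_degree_at_most_def)
  finally show ?thesis by (simp add: mult.commute)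
qed

text \<open>Each component of the remaining hyperedges has diameter at most \<open>k * k\<close>, so it inherits the
  coloring of the ball around a representative of the component.\<close>

lemma three_partite_remainder:
  assumes H: "hypergraph V E" and frag: "fragmented (comember E) k (V - X)"
    and bad: "\<And>v. v \<in> V \<Longrightarrow> \<not> three_partite UNIV (ball_edges E (k * k) v) \<Longrightarrow> v \<in> Y"
  shows "three_partite V {e \<in> E. e \<inter> (X \<union> Y) = {}}"
proof -
  let ?E = "{e \<in> E. e \<inter> (X \<union> Y) = {}}"
  let ?R = "comember ?E"
  have symR: "sym (?R\<^sup>*)" by (rule sym_rtrancl) (auto simp: sym_def comember_def)
  have inside: "u \<in> V - (X \<union> Y)" if "u \<in> e" "e \<in> ?E" for u e
    using H that by (auto simp: hypergraph_def)
  have stay: "w \<in> V - (X \<union> Y)" if "(v, w) \<in> ?R\<^sup>*" "v \<in> V - (X \<union> Y)" for v w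
    using that by induction (use inside in \<open>auto simp: comember_def\<close>)
  \<comment> \<open>The vertices of a component have the same reachable set, so \<open>SOME\<close>
    picks the same representative for all of them.\<close>
  define rep where "rep v = (SOME w. (v, w) \<in> ?R\<^sup>*)" for v
  have rep: "(v, rep v) \<in> ?R\<^sup>*" for v unfolding rep_def by (rule someI[of _ v]) simp
  have rep_eq: "rep u = rep v" if "(u, v) \<in> ?R" for u v
  proof -
    have uv: "(u, v) \<in> ?R\<^sup>*" and vu: "(v, u) \<in> ?R\<^sup>*" using that symR by (auto dest: symD)
    have "(u, w) \<in> ?R\<^sup>* \<longleftrightarrow> (v, w) \<in> ?R\<^sup>*" for w using uv vu by (meson rtrancl_trans)
    then show ?thesis by (simp add: rep_def)
  qed
  define good where "good w c \<longleftrightarrow> (\<forall>v. c v \<in> {1, 2, 3 :: nat}) \<and> (\<forall>e\<in>ball_edges E (k * k) w. inj_on c e)"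
    for w c
  \<comment> \<open>The default serves representatives in \<open>Y\<close>; they lie in no remaining
    hyperedge, so only the range of the colors counts there.\<close>
  define col where "col w = (if w \<in> V - Y then SOME c. good w c else (\<lambda>_. 1))" for w
  have col: "good w (col w)" if "w \<in> V - Y" for w
  proof -
    have "three_partite UNIV (ball_edges E (k * k) w)" using bad that by blast
    then have "\<exists>c. good w c" by (auto simp: three_partite_def good_def Pi_def)
    then show ?thesis using that by (simp add: col_def someI_ex)
  qed
  have range: "col w v \<in> {1, 2, 3}" for w v
    using col[of w] by (cases "w \<in> V - Y") (auto simp: good_def col_def)
  have "inj_on (\<lambda>v. col (rep v) v) e" if e: "e \<in> ?E" for e
  proof (cases "e = {}")
    case False
    then obtain v where v: "v \<in> e" by blast
    define w where "w = rep v"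
    have same: "rep u = w" if "u \<in> e" for u
      unfolding w_def using that v e by (intro rep_eq) (auto simp: comember_def)
    have w: "w \<in> V - (X \<union> Y)" using stay[OF rep[of v]] inside[OF v e] by (simp add: w_def)
    then have "w \<in> V - X" by blast
    with frag obtain p where p: "p \<subseteq> V - X" "w \<in> p" "card p \<le> k"
      "\<forall>u\<in>p. \<forall>x\<in>V - X. (u, x) \<in> comember E \<longrightarrow> x \<in> p" by (rule fragmentedE)
    \<comment> \<open>The component of \<open>w\<close> stays inside \<open>p\<close>, hence within
      the ball around \<open>w\<close>; so \<open>e\<close> is among the hyperedges that
      \<open>col w\<close> colors.\<close>
    have "v \<in> (reach E ^^ (k * k)) {w}"
    proof (rule rtrancl_reach)
      show "(w, v) \<in> ?R\<^sup>*" using rep[of v] symR by (auto simp: w_def dest: symD)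
      show "w \<in> p" "card p \<le> k" by (fact p)+
      show "finite p" using p(1) H by (auto simp: hypergraph_def intro: finite_subset)
      show "?R \<subseteq> comember E" by (auto simp: comember_def)
      show "x \<in> p" if "u \<in> p" "(u, x) \<in> ?R" for u x
      proof -
        have "x \<in> V - X" "(u, x) \<in> comember E" using that(2) inside by (auto simp: comember_def)
        then show ?thesis using p(4) that(1) by blast
      qed
    qed
    then have "e \<in> ball_edges E (k * k) w" using e v by (auto simp: ball_edges_def)
    then have "inj_on (col w) e" using col[of w] w by (auto simp: good_def)
    then show ?thesis using same by (simp add: inj_on_def)
  qed simp
  then show ?thesis unfolding three_partite_def using range
    by (intro bexI[of _ "\<lambda>v. col (rep v) v"]) auto
qed

text \<open>Deleting all hyperedges at \<open>X\<close> and at the bad vertices leaves a 3-partite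
  hypergraph, so more than \<open>\<epsilon> * d * n\<close> are deleted, while each vertex accounts
  for at most \<open>d\<close>. As \<open>X\<close> has at most \<open>\<epsilon> / 2 * n\<close>
  vertices, more than that many are bad.\<close>

lemma far_imp_many_bad_balls:
  assumes C: "bounded_treewidth_class d t n E"
    and far: "far_from d n \<epsilon> (\<lambda>n E. three_partite {..<n} E) E"
    and k: "2 * real (Suc t) \<le> \<epsilon> * real k" and eps: "0 < \<epsilon>"
  shows "\<epsilon> / 2 * real n < real (card {v \<in> {..<n}. \<not> three_partite UNIV (ball_edges E (k * k) v)})"
proof -
  let ?V = "{..<n}" and ?Y = "{v \<in> {..<n}. \<not> three_partite UNIV (ball_edges E (k * k) v)}"
  have H: "hypergraph ?V E" and unif: "three_uniform E" and deg: "max_degree_at_most ?V E d"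
    and tw: "hypergraph_treewidth ?V E \<le> t"
    using C by (auto simp: bounded_treewidth_class_def)
  have finE: "finite E" using H by (auto simp: hypergraph_def intro: finite_subset[of E "Pow ?V"])
  obtain X where X: "X \<subseteq> ?V" "k * card X \<le> Suc t * card ?V" "fragmented (comember E) k (?V - X)"
    using bounded_treewidth_separator[OF H tw] .
  let ?E = "{e \<in> E. e \<inter> (X \<union> ?Y) = {}}"
  have "three_partite ?V ?E" using H X(3) by (rule three_partite_remainder) blast
  moreover have "hypergraph ?V ?E" "three_uniform ?E"
    using H unif by (auto simp: hypergraph_def three_uniform_def)
  ultimately have dist: "\<epsilon> < edge_distance d n E ?E" using far by (auto simp: far_from_def)
  have diff: "E - ?E = {e \<in> E. e \<inter> (X \<union> ?Y) \<noteq> {}}" "?E - E = {}" by auto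
  have "card (E - ?E) \<le> d * card (X \<union> ?Y)"
    unfolding diff(1) using H deg by (rule card_touching_edges) (use X(1) in auto)
  also have "\<dots> \<le> d * (card X + card ?Y)" by (simp add: card_Un_le)
  finally have "real (card (E - ?E)) \<le> real (d * (card X + card ?Y))" by (rule of_nat_mono)
  then have le: "real (card (E - ?E)) \<le> real d * (real (card X) + real (card ?Y))"
    by (simp only: of_nat_mult of_nat_add)
  \<comment> \<open>If \<open>d\<close> or \<open>n\<close> is 0, division by zero makes every
    distance 0, so no input is \<open>\<epsilon>\<close>-far.\<close>
  have "real d * real n \<noteq> 0"
  proof
    assume "real d * real n = 0"
    then have "edge_distance d n E ?E = 0" unfolding edge_distance_def by (simp only: div_by_0)
    then show False using dist eps by linarith
  qed
  then have pos: "0 < real d" "0 < real n" by auto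
  have "\<epsilon> * (real d * real n) < real (card (E - ?E))"
    using dist unfolding edge_distance_def diff(2) pos_less_divide_eq[OF mult_pos_pos[OF pos]]
    by (simp only: card.empty of_nat_0 add_0_right)
  then have "real d * (\<epsilon> * real n) < real d * (real (card X) + real (card ?Y))"
    using le by (simp only: mult.left_commute)
  then have 1: "\<epsilon> * real n < real (card X) + real (card ?Y)"
    by (simp only: mult_less_cancel_left_pos[OF pos(1)])
  have kpos: "0 < real k" using k eps by (cases "k = 0") auto
  have "real k * real (card X) \<le> real (Suc t) * real n"
    using of_nat_mono[OF X(2), where ?'a = real] by (simp only: of_nat_mult card_lessThan)
  also have "\<dots> \<le> (\<epsilon> * real k / 2) * real n" using k by (intro mult_right_mono) auto
  finally have "real k * real (card X) \<le> real k * (\<epsilon> / 2 * real n)" by (simp add: algebra_simps)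
  then have "real (card X) \<le> \<epsilon> / 2 * real n" using kpos by (simp add: mult_le_cancel_left_pos)
  then show ?thesis using 1 by (simp add: algebra_simps)
qed

section \<open>The tester\<close>

primrec ask :: "(nat \<times> nat) list \<Rightarrow> (nat set option list \<Rightarrow> query_algorithm) \<Rightarrow> query_algorithm" where
  "ask [] c = c []"
| "ask (q # qs) c = Query (fst q) (snd q) (\<lambda>a. ask qs (\<lambda>as. c (a # as)))"

lemma run_ask: "run A (ask qs c) = run A (c (map (\<lambda>(i, j). query_answer A i j) qs))"
  by (induction qs arbitrary: c) (auto simp: case_prod_unfold)

lemma query_complexity_ask:
  assumes "\<And>as. length as = length qs \<Longrightarrow> query_complexity (c as) \<le> enat b"
  shows "query_complexity (ask qs c) \<le> enat (length qs + b)"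
  using assms
proof (induction qs arbitrary: c)
  case (Cons q qs)
  have "query_complexity (ask qs (\<lambda>as. c (a # as))) \<le> enat (length qs + b)" for a
    using Cons.prems by (intro Cons.IH) simp
  then have "(SUP a. query_complexity (ask qs (\<lambda>as. c (a # as)))) \<le> enat (length qs + b)"
    by (intro SUP_least)
  then have "eSuc (SUP a. query_complexity (ask qs (\<lambda>as. c (a # as)))) \<le> eSuc (enat (length qs + b))"
    by simp
  then show ?case by (simp add: eSuc_enat)
qed simp

text \<open>Query complexity is taken over all possible answers, including ones that present a set with
  more than three elements or an infinite one; the truncation bounds the branching.\<close>

definition answer_vertices :: "nat set option \<Rightarrow> nat list" where
  "answer_vertices a = (case a of None \<Rightarrow> [] | Some e \<Rightarrow> take 3 (sorted_list_of_set e))"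

text \<open>Every round queries the whole list again, old vertices and repetitions included. Thus
  the last batch alone contains all hyperedges that meet the ball, and the number of queries in a
  round depends only on \<open>d\<close> and the length of the list.\<close>

primrec explore :: "nat \<Rightarrow> nat \<Rightarrow> nat list \<Rightarrow> (nat set set \<Rightarrow> query_algorithm) \<Rightarrow> query_algorithm" where
  "explore d 0 vs c = ask (List.product vs [0..<d]) (\<lambda>as. c {e. Some e \<in> set as})"
| "explore d (Suc r) vs c =
     ask (List.product vs [0..<d]) (\<lambda>as. explore d r (vs @ concat (map answer_vertices as)) c)"

primrec explore_bound :: "nat \<Rightarrow> nat \<Rightarrow> nat \<Rightarrow> nat" where
  "explore_bound d 0 l = l * d"
| "explore_bound d (Suc r) l = l * d + explore_bound d r (l + 3 * (l * d))"

lemma explore_bound_mono: "l \<le> l' \<Longrightarrow> explore_bound d r l \<le> explore_bound d r l'"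
  by (induction r arbitrary: l l') (simp_all add: add_mono mult_le_mono)

lemma length_answer_vertices: "length (concat (map answer_vertices as)) \<le> 3 * length as"
proof (induction as)
  case (Cons a as)
  have "length (answer_vertices a) \<le> 3" by (simp add: answer_vertices_def split: option.split)
  then show ?case using Cons.IH by simp
qed simp

lemma set_concat_answer_vertices:
  "set (concat (map answer_vertices as)) = (\<Union>e\<in>{e. Some e \<in> set as}. set (answer_vertices (Some e)))"
proof (induction as)
  case (Cons a as)
  have "answer_vertices None = []" by (simp add: answer_vertices_def)
  with Cons.IH show ?case by (cases a) auto
qed simp

lemma query_complexity_explore:
  assumes "\<And>F. query_complexity (c F) \<le> enat b"
  shows "query_complexity (explore d r vs c) \<le> enat (explore_bound d r (length vs) + b)"
proof (induction r arbitrary: vs)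
  case 0
  show ?case
    using query_complexity_ask[of "List.product vs [0..<d]" "\<lambda>as. c {e. Some e \<in> set as}" b] assms
    by simp
next
  case (Suc r)
  let ?l = "length vs + 3 * (length vs * d)"
  have "query_complexity (explore d r (vs @ concat (map answer_vertices as)) c)
      \<le> enat (explore_bound d r ?l + b)" if "length as = length (List.product vs [0..<d])" for as
  proof -
    have "length (vs @ concat (map answer_vertices as)) \<le> ?l"
      using length_answer_vertices[of as] that by simp
    then have "explore_bound d r (length (vs @ concat (map answer_vertices as))) + b
        \<le> explore_bound d r ?l + b"
      by (intro add_right_mono explore_bound_mono)
    then show ?thesis using Suc.IH[of "vs @ concat (map answer_vertices as)"]
      by (meson enat_ord_simps(1) order_trans)
  qed
  then have "query_complexity (ask (List.product vs [0..<d])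
        (\<lambda>as. explore d r (vs @ concat (map answer_vertices as)) c))
      \<le> enat (length (List.product vs [0..<d]) + (explore_bound d r ?l + b))"
    by (rule query_complexity_ask)
  then show ?case by (simp add: add.assoc)
qed

lemma answers_incident:
  assumes rep: "represents d n A E" and H: "hypergraph {..<n} E"
  shows "Some e \<in> set (map (\<lambda>(i, j). query_answer A i j) (List.product vs [0..<d])) \<longleftrightarrow>
    e \<in> E \<and> e \<inter> set vs \<noteq> {}"
proof -
  have len: "length A = n" using rep by (simp add: represents_def)
  have row: "(\<exists>j<d. query_answer A i j = Some e) \<longleftrightarrow> e \<in> incident E i" for i
  proof (cases "i < n")
    case True
    then obtain es where l: "length (A ! i) = d" and es: "set es = incident E i"
      "A ! i = map Some es @ replicate (d - length es) None"
      using rep unfolding represents_def by blast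
    have "(\<exists>j<d. query_answer A i j = Some e) \<longleftrightarrow> Some e \<in> set (A ! i)"
      using True len l by (auto simp: query_answer_def in_set_conv_nth)
    also have "\<dots> \<longleftrightarrow> e \<in> incident E i" unfolding es(2) es(1)[symmetric] by auto
    finally show ?thesis .
  next
    case False
    \<comment> \<open>Lists beyond \<open>n\<close> answer \<open>None\<close>, and no hyperedge
      contains such a vertex.\<close>
    then show ?thesis using H len by (auto simp: query_answer_def incident_def hypergraph_def)
  qed
  have "Some e \<in> set (map (\<lambda>(i, j). query_answer A i j) (List.product vs [0..<d])) \<longleftrightarrow>
      (\<exists>i\<in>set vs. \<exists>j<d. query_answer A i j = Some e)"
    by (force simp: image_iff)
  then show ?thesis unfolding row by (auto simp: incident_def)
qed

lemma run_explore:
  assumes rep: "represents d n A E" and H: "hypergraph {..<n} E" and unif: "three_uniform E"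
  shows "run A (explore d r vs c) = run A (c {e \<in> E. e \<inter> (reach E ^^ r) (set vs) \<noteq> {}})"
proof (induction r arbitrary: vs)
  case 0
  show ?case by (simp add: run_ask answers_incident[OF rep H] del: set_map)
next
  case (Suc r)
  let ?as = "map (\<lambda>(i, j). query_answer A i j) (List.product vs [0..<d])"
  have vertices: "set (answer_vertices (Some e)) = e" if "e \<in> E" for e
  proof -
    have "finite e" "card e = 3" using that unif H
      by (auto simp: three_uniform_def hypergraph_def intro: finite_subset)
    then show ?thesis by (simp add: answer_vertices_def)
  qed
  have "{e. Some e \<in> set ?as} = {e \<in> E. e \<inter> set vs \<noteq> {}}"
    unfolding answers_incident[OF rep H] ..
  then have "set (concat (map answer_vertices ?as)) =
      (\<Union>e\<in>{e \<in> E. e \<inter> set vs \<noteq> {}}. set (answer_vertices (Some e)))"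
    unfolding set_concat_answer_vertices by (rule arg_cong)
  also have "\<dots> = \<Union>{e \<in> E. e \<inter> set vs \<noteq> {}}" using vertices by simp
  finally have vs': "set (vs @ concat (map answer_vertices ?as)) = reach E (set vs)"
    by (simp only: set_append reach_def)
  show ?case unfolding explore.simps run_ask Suc.IH vs' by (simp only: funpow_Suc_right o_apply)
qed

section \<open>Sampling and the error bound\<close>

text \<open>\<open>Choose (n - 1)\<close> is uniform on \<open>{..<n}\<close> for positive
  \<open>n\<close>; for \<open>n = 0\<close> it draws 0, whose queries reveal nothing. Deciding
  \<open>three_partite UNIV F\<close> costs no query.\<close>

primrec sampling_tester :: "nat \<Rightarrow> nat \<Rightarrow> nat \<Rightarrow> nat \<Rightarrow> query_algorithm" where
  "sampling_tester d r 0 n = Accept"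
| "sampling_tester d r (Suc s) n = Choose (n - 1) (\<lambda>v. explore d r [v]
     (\<lambda>F. if three_partite UNIV F then sampling_tester d r s n else Reject))"

lemma query_complexity_sampling_tester:
  "query_complexity (sampling_tester d r s n) \<le> enat (s * explore_bound d r 1)"
proof (induction s)
  case 0
  show ?case by (simp add: zero_enat_def)
next
  case (Suc s)
  have "query_complexity (if three_partite UNIV F then sampling_tester d r s n else Reject)
      \<le> enat (s * explore_bound d r 1)" for F :: "nat set set"
    using Suc.IH by simp
  then have "query_complexity (explore d r [v]
        (\<lambda>F. if three_partite UNIV F then sampling_tester d r s n else Reject))
      \<le> enat (explore_bound d r (length [v]) + s * explore_bound d r 1)" for v
    by (rule query_complexity_explore)
  then show ?case by (auto intro!: SUP_least)
qed

text \<open>The samples are independent and every sampled ball must pass, whence the power. The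
  denominator \<open>Suc (n - 1)\<close> keeps the formula valid for \<open>n = 0\<close>.\<close>

lemma accept_prob_sampling_tester:
  assumes rep: "represents d n A E" and H: "hypergraph {..<n} E" and unif: "three_uniform E"
  shows "accept_prob (sampling_tester d r s n) A =
    (real (card {v \<in> {..n - 1}. three_partite UNIV (ball_edges E r v)}) / real (Suc (n - 1))) ^ s"
proof (induction s)
  case 0
  show ?case by (simp add: accept_prob_def)
next
  case (Suc s)
  let ?g = "\<lambda>v. three_partite UNIV (ball_edges E r v)"
  have "accept_prob (sampling_tester d r (Suc s) n) A = 
     pmf (pmf_of_set {..n - 1} \<bind> (\<lambda>v. if ?g v then run A (sampling_tester d r s n) else return_pmf False)) True"
    by (simp add: accept_prob_def run_explore[OF assms] ball_edges_def if_distrib[of "run A"] cong: if_cong)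
  also have "\<dots> = (\<Sum>v\<in>{..n - 1}. pmf (if ?g v then run A (sampling_tester d r s n) else return_pmf False) True)
      / real (card {..n - 1})"
    by (simp add: pmf_bind integral_pmf_of_set)
  also have "(\<Sum>v\<in>{..n - 1}. pmf (if ?g v then run A (sampling_tester d r s n) else return_pmf False) True)
      = (\<Sum>v\<in>{..n - 1}. if ?g v then accept_prob (sampling_tester d r s n) A else 0)"
    by (intro sum.cong) (auto simp: accept_prob_def)
  also have "\<dots> = real (card {v \<in> {..n - 1}. ?g v}) * accept_prob (sampling_tester d r s n) A"
    by (simp add: sum.If_cases Int_def)
  finally show ?case using Suc.IH by simp
qed

theorem theorem8:
  fixes d t :: nat and \<epsilon> :: real
  assumes "0 < \<epsilon>" and "\<epsilon> < 1"
  shows "\<exists>(T :: nat \<Rightarrow> query_algorithm) (q :: nat).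
           is_tester d \<epsilon> (\<lambda>n E. three_partite {..<n} E) (bounded_treewidth_class d t) T \<and>
           (\<forall>n. query_complexity (T n) \<le> enat q)"
proof -
  \<comment> \<open>This \<open>k\<close> limits the separator to \<open>\<epsilon> / 2 * n\<close>
    vertices, half of the distance budget.\<close>
  obtain k :: nat where "2 * real (Suc t) / \<epsilon> < real k" using reals_Archimedean2 by blast
  then have k: "2 * real (Suc t) \<le> \<epsilon> * real k" using assms(1) by (simp add: divide_less_eq mult.commute)
  have "0 \<le> 1 - \<epsilon> / 2" "1 - \<epsilon> / 2 < 1" using assms by auto
  \<comment> \<open>On a far input each sample misses the bad vertices with probability at most
    \<open>1 - \<epsilon> / 2\<close>; \<open>s\<close> samples bring the error below 1/3.\<close>
  then obtain s where s: "(1 - \<epsilon> / 2) ^ s < 1 / 3"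
    using real_arch_pow_inv[of "1 / 3" "1 - \<epsilon> / 2"] by auto
  have "is_tester d \<epsilon> (\<lambda>n E. three_partite {..<n} E) (bounded_treewidth_class d t)
      (sampling_tester d (k * k) s)"
    unfolding is_tester_def
  proof (intro allI impI, elim conjE, intro conjI impI)
    fix n E A
    assume C: "bounded_treewidth_class d t n E" and rep: "represents d n A E"
    then have H: "hypergraph {..<n} E" and unif: "three_uniform E"
      by (auto simp: bounded_treewidth_class_def)
    let ?g = "\<lambda>v. three_partite UNIV (ball_edges E (k * k) v)"
    note prob = accept_prob_sampling_tester[OF rep H unif, of "k * k" s]
    show "2 / 3 \<le> accept_prob (sampling_tester d (k * k) s n) A" if part: "three_partite {..<n} E"
    proof -
      obtain c where c: "c \<in> {..<n} \<rightarrow> {1, 2, 3 :: nat}" "\<forall>e\<in>E. inj_on c e"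
        using part unfolding three_partite_def by (rule bexE)
      \<comment> \<open>The balls are tested for colorings of \<open>UNIV\<close>, so
        \<open>c\<close> is extended by color 1; hyperedges lie in \<open>{..<n}\<close> and are not
        affected.\<close>
      let ?c = "\<lambda>v. if v < n then c v else 1"
      have "c v \<in> {1, 2, 3}" if "v < n" for v using funcset_mem[OF c(1)] that by simp
      then have "?c \<in> UNIV \<rightarrow> {1, 2, 3}" by (simp add: Pi_def)
      moreover have "inj_on ?c e" if "e \<in> E" for e
      proof -
        have "inj_on c e" "e \<subseteq> {..<n}" using that c(2) H by (auto simp: hypergraph_def)
        then show ?thesis by (auto simp: inj_on_def subset_iff)
      qed
      ultimately have "?g v" for v
        unfolding three_partite_def ball_edges_def by blast
      then show ?thesis by (simp add: prob)
    qed
    show "accept_prob (sampling_tester d (k * k) s n) A \<le> 1 / 3"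
      if "far_from d n \<epsilon> (\<lambda>n E. three_partite {..<n} E) E"
    proof -
      let ?B = "{v \<in> {..<n}. \<not> ?g v}"
      have B: "\<epsilon> / 2 * real n < real (card ?B)" by (rule far_imp_many_bad_balls[OF C that k assms(1)])
      \<comment> \<open>The strict inequality excludes \<open>n = 0\<close>, so the samples are
        indeed vertices.\<close>
      have n: "0 < n" using B by (cases "n = 0") auto
      then have V: "{..n - 1} = {..<n}" by auto
      have "{v \<in> {..n - 1}. ?g v} = {..<n} - ?B" unfolding V by auto
      then have "card {v \<in> {..n - 1}. ?g v} = card {..<n} - card ?B"
        using card_Diff_subset[of ?B "{..<n}"] by fastforce
      moreover have "card ?B \<le> card {..<n}" by (rule card_mono) auto
      ultimately have "real (card {v \<in> {..n - 1}. ?g v}) = real n - real (card ?B)"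
        by (simp only: of_nat_diff card_lessThan)
      then have "real (card {v \<in> {..n - 1}. ?g v}) \<le> (1 - \<epsilon> / 2) * real n"
        using B unfolding left_diff_distrib by linarith
      then have "real (card {v \<in> {..n - 1}. ?g v}) / real (Suc (n - 1)) \<le> 1 - \<epsilon> / 2"
        using n by (simp add: divide_le_eq)
      then have "accept_prob (sampling_tester d (k * k) s n) A \<le> (1 - \<epsilon> / 2) ^ s"
        unfolding prob by (rule power_mono) simp
      then show ?thesis using s by linarith
    qed
  qed
  then show ?thesis using query_complexity_sampling_tester by blast
qed

end
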